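(* If $T$ is a tree with order $n\geq 3$ in which every vertex is either a leaf or a support vertex, then $\mathrm{gp}(\mathcal{M}(T))=2\ell(T)$ and $T$ is meagre.
   Context: A leaf is a vertex of degree one; $\ell(T)$ is the number of leaves of $T$; a support vertex is a vertex adjacent to a leaf. A set $S$ of vertices of a graph $H$ is a general position set if no shortest path in $H$ contains three or more vertices of $S$; $\mathrm{gp}(H)$ is the number of vertices in a largest general position set of $H$. The Mycielskian $\mathcal{M}(G)$ of a graph $G$ with vertex set $V$ and edge set $E$ has vertex set $V\cup V'\cup\{u^*\}$, where $V'=\{u' : u\in V\}$ is a disjoint copy of $V$ and $u^*$ is an additional vertex (the root), and edge set $E\cup\{uv' : uv\in E\}\cup\{v'u^* : v'\in V'\}$ (for each edge $uv\in E$ both $uv'$ and $vu'$ are included). An independent $4$-position set of $G$ is a subset $S\subseteq V(G)$ that is an independent set and such that no shortest path of $G$ of length at most $4$ passes through three or more vertices of $S$; $\mathrm{ip}_4(G)$ is the largest number of vertices in such a set. A non-complete graph $G$ with order $n\geq 3$ is meagre if $\mathrm{gp}(\mathcal{M}(G))=\max\{n,2\,\mathrm{ip}_4(G)\}$. *)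

theory Defs
  imports "Graph_Theory.Graph_Theory"
begin

text \<open>
  A finite simple undirected graph is a \<^locale>\<open>pair_graph\<close>: a finite, loop-free, symmetric
  set of arcs, so every edge \<open>uv\<close> is present as the two arcs \<open>(u, v)\<close> and \<open>(v, u)\<close>.
\<close>

section \<open>Trees, leaves and support vertices\<close>

text \<open>
  The library predicates \<open>forest\<close> and \<open>tree\<close> do not describe undirected trees:
  in a symmetric digraph every edge gives a directed cycle \<open>u, v, u\<close>.
  We therefore exclude cycles with at least three distinct vertices.
\<close>

definition undirected_cycle :: "'a pair_pre_digraph \<Rightarrow> 'a list \<Rightarrow> bool" where
  "undirected_cycle G c \<longleftrightarrow> vpath c (with_proj G) \<and> 3 \<le> length c \<and> (last c, hd c) \<in> parcs G"

definition undirected_tree :: "'a pair_pre_digraph \<Rightarrow> bool" where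
  "undirected_tree G \<longleftrightarrow>
     pair_graph G \<and> Digraph_Component.connected (with_proj G) \<and> \<not> (\<exists>c. undirected_cycle G c)"

text \<open>By symmetry, the degree of a vertex is its out-degree.\<close>

definition leaf :: "'a pair_pre_digraph \<Rightarrow> 'a \<Rightarrow> bool" where
  "leaf G v \<longleftrightarrow> v \<in> pverts G \<and> out_degree (with_proj G) v = 1"

definition support_vertex :: "'a pair_pre_digraph \<Rightarrow> 'a \<Rightarrow> bool" where
  "support_vertex G v \<longleftrightarrow> v \<in> pverts G \<and> (\<exists>u. leaf G u \<and> (v, u) \<in> parcs G)"

definition num_leaves :: "'a pair_pre_digraph \<Rightarrow> nat" where
  "num_leaves G = card {v. leaf G v}"

section \<open>General position and independent position\<close>

definition shortest_path :: "'a pair_pre_digraph \<Rightarrow> 'a list \<Rightarrow> bool" where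
  "shortest_path G p \<longleftrightarrow>
     vpath p (with_proj G) \<and>
     (\<forall>q. vpath q (with_proj G) \<and> hd q = hd p \<and> last q = last p
        \<longrightarrow> vwalk_length p \<le> vwalk_length q)"

definition general_position_set :: "'a pair_pre_digraph \<Rightarrow> 'a set \<Rightarrow> bool" where
  "general_position_set G S \<longleftrightarrow>
     S \<subseteq> pverts G \<and> \<not> (\<exists>p. shortest_path G p \<and> 3 \<le> card (S \<inter> set p))"

definition gp :: "'a pair_pre_digraph \<Rightarrow> nat" where
  "gp G = Max {card S | S. general_position_set G S}"

definition independent_set :: "'a pair_pre_digraph \<Rightarrow> 'a set \<Rightarrow> bool" where
  "independent_set G S \<longleftrightarrow> S \<subseteq> pverts G \<and> (\<forall>u \<in> S. \<forall>v \<in> S. (u, v) \<notin> parcs G)"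

definition independent_position_set :: "nat \<Rightarrow> 'a pair_pre_digraph \<Rightarrow> 'a set \<Rightarrow> bool" where
  "independent_position_set k G S \<longleftrightarrow>
     independent_set G S \<and>
     \<not> (\<exists>p. shortest_path G p \<and> vwalk_length p \<le> k \<and> 3 \<le> card (S \<inter> set p))"

definition ip :: "nat \<Rightarrow> 'a pair_pre_digraph \<Rightarrow> nat" where
  "ip k G = Max {card S | S. independent_position_set k G S}"

section \<open>The Mycielskian\<close>

datatype 'a myc_vertex = Orig 'a | Copy 'a | Root

definition mycielskian :: "'a pair_pre_digraph \<Rightarrow> 'a myc_vertex pair_pre_digraph" where
  "mycielskian G =
     \<lparr> pverts = Orig ` pverts G \<union> Copy ` pverts G \<union> {Root},
       parcs = {(Orig u, Orig v) | u v. (u, v) \<in> parcs G}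
             \<union> {(Orig u, Copy v) | u v. (u, v) \<in> parcs G}
             \<union> {(Copy u, Orig v) | u v. (u, v) \<in> parcs G}
             \<union> {(Copy v, Root) | v. v \<in> pverts G}
             \<union> {(Root, Copy v) | v. v \<in> pverts G} \<rparr>"

lemma pair_graph_mycielskian:
  assumes "pair_graph G"
  shows "pair_graph (mycielskian G)"
proof -
  interpret pair_graph G by (rule assms)
  have sym: "sym (parcs G)"
    using pair_sym_arcs by (simp add: symmetric_def)
  have fin: "finite (pverts (mycielskian G))"
    by (simp add: mycielskian_def pair_finite_verts)
  have sub: "parcs (mycielskian G) \<subseteq> pverts (mycielskian G) \<times> pverts (mycielskian G)"
    by (auto simp: mycielskian_def dest: arc_fst_in_verts arc_snd_in_verts)
  show ?thesis
  proof
    show "finite (pverts (mycielskian G))" by (rule fin)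
    show "finite (parcs (mycielskian G))"
      using finite_subset[OF sub] fin by blast
    show "symmetric (with_proj (mycielskian G))"
      using sym by (auto simp: symmetric_def mycielskian_def sym_def)
  next
    fix e assume "e \<in> parcs (mycielskian G)"
    with sub show "fst e \<in> pverts (mycielskian G)" "snd e \<in> pverts (mycielskian G)"
      by (auto simp: mem_Times_iff)
  next
    fix e assume "e \<in> parcs (mycielskian G)"
    then show "fst e \<noteq> snd e"
      by (auto simp: mycielskian_def dest: pair_no_loops)
  qed
qed

definition meagre :: "'a pair_pre_digraph \<Rightarrow> bool" where
  "meagre G \<longleftrightarrow>
     pair_graph G \<and> 3 \<le> card (pverts G) \<and>
     \<not> complete_digraph (card (pverts G)) (with_proj G) \<and>
     gp (mycielskian G) = max (card (pverts G)) (2 * ip 4 G)"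

end

theory Submission
  imports Defs
begin

text \<open>
  Call three vertices collinear if the distance between two of them is the sum of their
  distances to the third. A set is in general position exactly if it contains no collinear triple
  (\<open>general_position_set_iff\<close>), so the theorem is about the metric of the Mycielskian.
  With \<open>d\<close> the distance of the graph, that metric is \<open>min d 4\<close> between two originals,
  \<open>min d 3\<close> between an original and the copy of another vertex, and \<open>2\<close> between two copies
  or between a vertex and its own copy: short detours stay over the graph, long ones go through
  the root.

  Lower bound: the leaves together with their copies are in general position. Their mutual
  distances are at least \<open>2\<close> and at most \<open>4\<close>, so the middle vertex of a collinear triple would be
  at distance \<open>2\<close> from the originals of two leaves that are \<open>4\<close> apart. Such a vertex lies over a leaf \<open>w\<close>,
  and both connections would have to use the only neighbour of \<open>w\<close>
  (\<open>general_position_doubled_leaves\<close>).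

  Upper bound: attach to every non-leaf one of its leaves. Different non-leaves get
  different leaves, so a vertex weight that is at most \<open>k\<close> on every leaf and on every such pair
  has total at most \<open>k\<close> times the number of leaves (\<open>weight_le_leaves\<close>). Give a vertex the number
  of elements of \<open>S\<close> among itself and its copy. If all pairs have weight at most \<open>2\<close>, this
  yields the bound. A pair of a vertex \<open>s\<close> and its leaf \<open>l\<close> of larger weight must contribute
  both copies and one original, and then there is an adjacent pair of an original and a copy in
  \<open>S\<close>. This pair is collinear with so many vertices that almost nothing else fits
  into \<open>S\<close>, and counting against the order of the graph, itself at most twice
  the number of leaves, suffices. If the root is in \<open>S\<close>, there is at most one copy in \<open>S\<close> and the
  originals are at most as many as the leaves (\<open>general_position_card_le\<close>).

  Finally, an independent set contains no leaf together with its neighbour, so weights with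
  \<open>k = 1\<close> show that the independent position number is the number of leaves, and the
  maximum in the definition of meagre graphs is attained by the second term.
\<close>

section \<open>Distances and collinear triples\<close>

text \<open>
  Powers of the arc relation record a walk by its ends and its length, so that concatenation and reversal are
  available without reference to vertex lists.
\<close>

definition gdist :: "'a pair_pre_digraph \<Rightarrow> 'a \<Rightarrow> 'a \<Rightarrow> nat" where
  "gdist G u v = (LEAST k. (u, v) \<in> parcs G ^^ k)"

lemma gdist_le: "(u, v) \<in> parcs G ^^ k \<Longrightarrow> gdist G u v \<le> k"
  unfolding gdist_def by (rule Least_le)

lemma gdist_self [simp]: "gdist G u u = 0"
  using gdist_le[of u u 0 G] by simp

lemma gdist_eqI:
  assumes "(u, v) \<in> parcs G ^^ k" "\<And>j. j < k \<Longrightarrow> (u, v) \<notin> parcs G ^^ j"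
  shows "gdist G u v = k"
  unfolding gdist_def using assms by (intro Least_equality) (auto simp: not_less[symmetric])

lemma vwalk_iff_nth:
  "vwalk p (with_proj G) \<longleftrightarrow>
     p \<noteq> [] \<and> set p \<subseteq> pverts G \<and> (\<forall>i < length p - 1. (p ! i, p ! Suc i) \<in> parcs G)"
proof -
  have "set (vwalk_arcs p) \<subseteq> parcs G \<longleftrightarrow> (\<forall>i < length p - 1. (p ! i, p ! Suc i) \<in> parcs G)"
    by (induction p rule: vwalk_arcs.induct) (simp_all add: All_less_Suc2)
  then show ?thesis by (auto simp: vwalk_def)
qed

lemma relpow_nth_vwalk:
  assumes "vwalk p (with_proj G)" "i \<le> j" "j < length p"
  shows "(p ! i, p ! j) \<in> parcs G ^^ (j - i)"
  unfolding relpow_fun_conv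
  using assms by (intro exI[of _ "\<lambda>k. p ! (i + k)"]) (auto simp: vwalk_iff_nth)

locale connected_pair_graph = pair_graph +
  assumes connected_rtrancl: "u \<in> pverts G \<Longrightarrow> v \<in> pverts G \<Longrightarrow> (u, v) \<in> (parcs G)\<^sup>*"
begin

lemma arc_sym: "(u, v) \<in> parcs G \<Longrightarrow> (v, u) \<in> parcs G"
  using pair_sym_arcs by (auto simp: symmetric_def dest: symD)

lemma gdist_walk:
  assumes "u \<in> pverts G" "v \<in> pverts G"
  shows "(u, v) \<in> parcs G ^^ gdist G u v"
  unfolding gdist_def
  using connected_rtrancl[OF assms] by (auto simp: rtrancl_power intro: LeastI)

lemma relpow_sym: "(u, v) \<in> parcs G ^^ k \<Longrightarrow> (v, u) \<in> parcs G ^^ k"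
proof (induction k arbitrary: v)
  case (Suc k)
  then obtain w where "(u, w) \<in> parcs G ^^ k" "(w, v) \<in> parcs G" by auto
  then show ?case using Suc.IH arc_sym relpow_Suc_I2 by metis
qed simp

lemma gdist_sym: "gdist G u v = gdist G v u"
  unfolding gdist_def using relpow_sym by metis

lemma gdist_eq_0_iff:
  assumes "u \<in> pverts G" "v \<in> pverts G"
  shows "gdist G u v = 0 \<longleftrightarrow> u = v"
  using gdist_walk[OF assms] gdist_le[of u v 0 G] by auto

lemma gdist_eq_1_iff:
  assumes "u \<in> pverts G" "v \<in> pverts G"
  shows "gdist G u v = Suc 0 \<longleftrightarrow> (u, v) \<in> parcs G"
proof
  assume "gdist G u v = Suc 0"
  then show "(u, v) \<in> parcs G" using gdist_walk[OF assms] by simp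
next
  assume "(u, v) \<in> parcs G"
  then show "gdist G u v = Suc 0"
    using gdist_le[of u v 1 G] gdist_eq_0_iff[OF assms] no_loops'[of u v] by fastforce
qed

lemma gdist_triangle:
  assumes "u \<in> pverts G" "v \<in> pverts G" "w \<in> pverts G"
  shows "gdist G u w \<le> gdist G u v + gdist G v w"
  using gdist_walk[of u v] gdist_walk[of v w] assms
  by (intro gdist_le) (auto simp: relpow_add)

text \<open>
  Shortest walks from \<open>x\<close> to \<open>y\<close> and from \<open>y\<close> to \<open>z\<close> compose to a walk whose length is the
  distance from \<open>x\<close> to \<open>z\<close>, and a walk of that length cannot repeat a vertex.
\<close>

lemma ex_minimal_vpath_through:
  assumes "x \<in> pverts G" "y \<in> pverts G" "z \<in> pverts G"
    and col: "gdist G x z = gdist G x y + gdist G y z"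
  obtains p where "vpath p (with_proj G)" "hd p = x" "last p = z" "y \<in> set p"
    "length p = Suc (gdist G x z)"
proof -
  let ?a = "gdist G x y" and ?b = "gdist G y z"
  obtain f where f: "f 0 = x" "f ?a = y" "\<forall>i<?a. (f i, f (Suc i)) \<in> parcs G"
    using gdist_walk[OF assms(1,2)] unfolding relpow_fun_conv by blast
  obtain g where g: "g 0 = y" "g ?b = z" "\<forall>i<?b. (g i, g (Suc i)) \<in> parcs G"
    using gdist_walk[OF assms(2,3)] unfolding relpow_fun_conv by blast
  define h where "h i = (if i \<le> ?a then f i else g (i - ?a))" for i
  let ?n = "?a + ?b"
  have h: "h 0 = x" "h ?a = y" "h ?n = z"
    using f g by (auto simp: h_def)
  have step: "(h i, h (Suc i)) \<in> parcs G" if "i < ?n" for i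
  proof -
    consider "i < ?a" | "i = ?a" | "i > ?a" by linarith
    then show ?thesis
    proof cases
      case 1 then show ?thesis using f by (auto simp: h_def)
    next
      case 2 then show ?thesis using f g that by (auto simp: h_def)
    next
      case 3
      then have "(g (i - ?a), g (Suc (i - ?a))) \<in> parcs G" using g that by auto
      with 3 show ?thesis by (auto simp: h_def Suc_diff_le)
    qed
  qed
  have seg: "(h i, h j) \<in> parcs G ^^ (j - i)" if "i \<le> j" "j \<le> ?n" for i j
    unfolding relpow_fun_conv using that step by (intro exI[of _ "\<lambda>k. h (i + k)"]) auto
  (* A repeated vertex would let the walk be shortened below the distance. *)
  have inj: "h i \<noteq> h j" if "i < j" "j \<le> ?n" for i j
  proof
    assume eq: "h i = h j"
    have "(x, h i) \<in> parcs G ^^ i" "(h i, z) \<in> parcs G ^^ (?n - j)"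
      using seg[of 0 i] seg[of j ?n] that h eq by auto
    then have "(x, z) \<in> parcs G ^^ (i + (?n - j))" by (auto simp: relpow_add)
    then have "gdist G x z \<le> i + (?n - j)" by (rule gdist_le)
    with that col show False by linarith
  qed
  define p where "p = map h [0..<Suc ?n]"
  have len: "length p = Suc ?n" by (simp add: p_def)
  have nth: "p ! i = h i" if "i \<le> ?n" for i
    using that unfolding p_def by (subst nth_map) (auto simp del: upt_Suc)
  have "h i \<in> pverts G" if "i \<le> ?n" for i
    using that step[of "i - 1"] h(1) assms(1) by (cases i) (auto dest: in_arcsD2)
  then have "set p \<subseteq> pverts G" by (auto simp: p_def)
  then have "vwalk p (with_proj G)"
    unfolding vwalk_iff_nth using len nth step by (auto simp: p_def)
  moreover have "distinct p"
    unfolding distinct_conv_nth len using nth inj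
    by (metis less_Suc_eq_le nat_neq_iff)
  ultimately have "vpath p (with_proj G)" by (simp add: vpath_def)
  moreover have "p \<noteq> []" using len by auto
  then have "hd p = x" "last p = z"
    using nth[of 0] nth[of ?n] h len by (auto simp: hd_conv_nth last_conv_nth)
  moreover have "y \<in> set p" using nth[of ?a] h(2) len by (metis le_add1 less_Suc_eq_le nth_mem)
  ultimately show ?thesis using that len col by simp
qed

text \<open>
  The pieces of the path before \<open>i\<close>, from \<open>i\<close> to \<open>j\<close>, and after \<open>j\<close> bound the three distances
  from above. Their lengths add up to the distance of the ends, so the triangle inequality
  leaves no slack in any of them.
\<close>

lemma shortest_path_gdist:
  assumes "shortest_path G p" "i \<le> j" "j < length p"
  shows "gdist G (p ! i) (p ! j) = j - i"
proof -
  have vw: "vwalk p (with_proj G)" and min: "\<And>q. vpath q (with_proj G) \<Longrightarrow> hd q = hd p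
      \<Longrightarrow> last q = last p \<Longrightarrow> length p - 1 \<le> length q - 1"
    using assms(1) by (auto simp: shortest_path_def vpath_def)
  have ne: "p \<noteq> []" and sub: "set p \<subseteq> pverts G" using vw by (auto simp: vwalk_iff_nth)
  let ?n = "length p - 1"
  have ends: "p ! 0 = hd p" "p ! ?n = last p" using ne by (auto simp: hd_conv_nth last_conv_nth)
  have inV: "k < length p \<Longrightarrow> p ! k \<in> pverts G" for k using sub by auto
  have "hd p \<in> pverts G" "last p \<in> pverts G" using ne sub by auto
  then obtain q where q: "vpath q (with_proj G)" "hd q = hd p" "last q = last p"
      "length q = Suc (gdist G (hd p) (last p))"
    using ex_minimal_vpath_through[of "hd p" "hd p" "last p"] gdist_eq_0_iff[of "hd p" "hd p"] by auto
  then have "?n \<le> gdist G (p ! 0) (p ! ?n)"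
    unfolding ends using min[OF q(1-3)] by simp
  also have "\<dots> \<le> gdist G (p ! 0) (p ! i) + gdist G (p ! i) (p ! j) + gdist G (p ! j) (p ! ?n)"
    using gdist_triangle[of "p ! 0" "p ! i" "p ! ?n"] gdist_triangle[of "p ! i" "p ! j" "p ! ?n"]
      inV assms by (simp add: ne)
  also have "gdist G (p ! 0) (p ! i) \<le> i"
    using relpow_nth_vwalk[OF vw, of 0 i] assms by (intro gdist_le) auto
  also have "gdist G (p ! j) (p ! ?n) \<le> ?n - j"
    using relpow_nth_vwalk[OF vw, of j ?n] assms by (intro gdist_le) auto
  finally have "j - i \<le> gdist G (p ! i) (p ! j)" using assms by linarith
  moreover have "gdist G (p ! i) (p ! j) \<le> j - i"
    using relpow_nth_vwalk[OF vw] assms by (intro gdist_le) auto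
  ultimately show ?thesis by simp
qed

text \<open>
  This reduces the position conditions to the metric. The bound \<open>k\<close> serves sets that are only
  tested against paths of bounded length; a triple on a long path already lies on its
  subpath between the outer two vertices.
\<close>

lemma triple_on_shortest_path_iff:
  assumes "S \<subseteq> pverts G"
  shows "(\<exists>p. shortest_path G p \<and> vwalk_length p \<le> k \<and> 3 \<le> card (S \<inter> set p)) \<longleftrightarrow>
    (\<exists>x\<in>S. \<exists>y\<in>S. \<exists>z\<in>S. x \<noteq> y \<and> y \<noteq> z \<and> x \<noteq> z \<and>
       gdist G x z = gdist G x y + gdist G y z \<and> gdist G x z \<le> k)" (is "?L \<longleftrightarrow> ?R")
proof
  assume ?L
  then obtain p where p: "shortest_path G p" "length p - 1 \<le> k" "3 \<le> card (S \<inter> set p)" by auto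
  define I where "I = {i. i < length p \<and> p ! i \<in> S}"
  have "S \<inter> set p = (\<lambda>i. p ! i) ` I" by (auto simp: I_def in_set_conv_nth)
  then have "3 \<le> card I"
    using p(3) card_image_le[of I "\<lambda>i. p ! i"] by (simp add: I_def)
  then obtain J where J: "J \<subseteq> I" "card J = 3" by (meson obtain_subset_with_card_n)
  then have "finite J" by (metis card.infinite zero_neq_numeral)
  define xs where "xs = sorted_list_of_set J"
  have xs: "length xs = 3" "set xs = J" "sorted xs" "distinct xs"
    using \<open>finite J\<close> J by (auto simp: xs_def)
  obtain a b c where abc: "xs = [a, b, c]"
    using xs(1) by (auto simp: numeral_3_eq_3 length_Suc_conv)
  then have lt: "a < b" "b < c" and I: "a \<in> I" "b \<in> I" "c \<in> I" using xs J by auto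
  have dist: "distinct p" using p(1) by (simp add: shortest_path_def vpath_def)
  have len: "a < length p" "b < length p" "c < length p" using I by (auto simp: I_def)
  show ?R
  proof (intro bexI conjI)
    show "p ! a \<noteq> p ! b" "p ! b \<noteq> p ! c" "p ! a \<noteq> p ! c"
      using dist lt len by (auto simp: nth_eq_iff_index_eq)
    show "gdist G (p ! a) (p ! c) = gdist G (p ! a) (p ! b) + gdist G (p ! b) (p ! c)"
      using shortest_path_gdist[OF p(1)] lt len by simp
    show "gdist G (p ! a) (p ! c) \<le> k"
      using shortest_path_gdist[OF p(1), of a c] lt len p(2) by simp
  qed (use I in \<open>auto simp: I_def\<close>)
next
  assume ?R
  then obtain x y z where xyz: "x \<in> S" "y \<in> S" "z \<in> S" "x \<noteq> y" "y \<noteq> z" "x \<noteq> z"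
    "gdist G x z = gdist G x y + gdist G y z" "gdist G x z \<le> k" by blast
  then obtain p where p: "vpath p (with_proj G)" "hd p = x" "last p = z" "y \<in> set p"
    "length p = Suc (gdist G x z)"
    using ex_minimal_vpath_through assms by (metis subsetD)
  have ne: "p \<noteq> []" using p(5) by auto
  have "length p - 1 \<le> length q - 1"
    if q: "vpath q (with_proj G)" "hd q = hd p" "last q = last p" for q
  proof -
    have vw: "vwalk q (with_proj G)" using q by (simp add: vpath_def)
    then have "q \<noteq> []" by (simp add: vwalk_iff_nth)
    then have "(x, z) \<in> parcs G ^^ (length q - 1)"
      using relpow_nth_vwalk[OF vw, of 0 "length q - 1"] q p by (simp add: hd_conv_nth last_conv_nth)
    then show ?thesis using p(5) gdist_le by fastforce
  qed
  then have "shortest_path G p" using p by (simp add: shortest_path_def)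
  moreover have "{x, y, z} \<subseteq> S \<inter> set p" using xyz p ne by auto
  then have "card {x, y, z} \<le> card (S \<inter> set p)" by (intro card_mono) auto
  then have "3 \<le> card (S \<inter> set p)" using xyz by simp
  moreover have "vwalk_length p \<le> k" using p(5) xyz(8) by simp
  ultimately show ?L by (intro exI[of _ p] conjI)
qed

lemma general_position_set_iff:
  "general_position_set G S \<longleftrightarrow> S \<subseteq> pverts G \<and>
    (\<forall>x\<in>S. \<forall>y\<in>S. \<forall>z\<in>S. x \<noteq> y \<longrightarrow> y \<noteq> z \<longrightarrow> x \<noteq> z \<longrightarrow>
       gdist G x z \<noteq> gdist G x y + gdist G y z)" (is "_ \<longleftrightarrow> _ \<and> ?R")
proof (cases "S \<subseteq> pverts G")
  case True
  have "general_position_set G S \<longleftrightarrow>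
    (\<forall>k. \<not> (\<exists>p. shortest_path G p \<and> vwalk_length p \<le> k \<and> 3 \<le> card (S \<inter> set p)))"
    using True unfolding general_position_set_def by blast
  also have "\<dots> \<longleftrightarrow> (\<forall>k. \<not> (\<exists>x\<in>S. \<exists>y\<in>S. \<exists>z\<in>S. x \<noteq> y \<and> y \<noteq> z \<and> x \<noteq> z \<and>
       gdist G x z = gdist G x y + gdist G y z \<and> gdist G x z \<le> k))"
    unfolding triple_on_shortest_path_iff[OF True] ..
  also have "\<dots> \<longleftrightarrow> ?R" by fast
  finally show ?thesis using True by simp
qed (simp add: general_position_set_def)

lemma independent_position_setI:
  assumes "independent_set G S"
    and "\<And>x y z. x \<in> S \<Longrightarrow> y \<in> S \<Longrightarrow> z \<in> S \<Longrightarrow> x \<noteq> y \<Longrightarrow> y \<noteq> z \<Longrightarrow> x \<noteq> z \<Longrightarrow>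
      gdist G x z \<noteq> gdist G x y + gdist G y z"
  shows "independent_position_set k G S"
proof -
  have "S \<subseteq> pverts G" using assms(1) by (simp add: independent_set_def)
  then show ?thesis
    using assms unfolding independent_position_set_def triple_on_shortest_path_iff[OF \<open>S \<subseteq> _\<close>]
    by blast
qed

end

lemma Max_card_eqI:
  assumes "finite V" "\<And>S. P S \<Longrightarrow> S \<subseteq> V" "\<And>S. P S \<Longrightarrow> card S \<le> m" "P S0" "card S0 = m"
  shows "Max {card S | S. P S} = m"
proof (rule Max_eqI)
  show "finite {card S | S. P S}"
    by (rule finite_subset[of _ "{..m}"]) (use assms(3) in auto)
qed (use assms in auto)

section \<open>Distances in the Mycielskian\<close>

lemma mycielskian_verts [simp]:
  "Orig v \<in> pverts (mycielskian G) \<longleftrightarrow> v \<in> pverts G"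
  "Copy v \<in> pverts (mycielskian G) \<longleftrightarrow> v \<in> pverts G"
  "Root \<in> pverts (mycielskian G)"
  by (auto simp: mycielskian_def)

lemma mycielskian_arcs [simp]:
  "(Orig u, Orig v) \<in> parcs (mycielskian G) \<longleftrightarrow> (u, v) \<in> parcs G"
  "(Orig u, Copy v) \<in> parcs (mycielskian G) \<longleftrightarrow> (u, v) \<in> parcs G"
  "(Copy u, Orig v) \<in> parcs (mycielskian G) \<longleftrightarrow> (u, v) \<in> parcs G"
  "(Copy u, Copy v) \<notin> parcs (mycielskian G)"
  "(Orig u, Root) \<notin> parcs (mycielskian G)"
  "(Root, Orig u) \<notin> parcs (mycielskian G)"
  "(Copy u, Root) \<in> parcs (mycielskian G) \<longleftrightarrow> u \<in> pverts G"
  "(Root, Copy u) \<in> parcs (mycielskian G) \<longleftrightarrow> u \<in> pverts G"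
  "(Root, Root) \<notin> parcs (mycielskian G)"
  by (auto simp: mycielskian_def)

lemma ex_myc_vertex:
  "(\<exists>x. P x) \<longleftrightarrow> (\<exists>u. P (Orig u)) \<or> (\<exists>u. P (Copy u)) \<or> P Root"
  by (metis myc_vertex.exhaust)

lemma relpow_2: "(u, v) \<in> R ^^ 2 \<longleftrightarrow> (\<exists>w. (u, w) \<in> R \<and> (w, v) \<in> R)"
  by (auto simp: numeral_2_eq_2)

lemma relpow_3: "(u, v) \<in> R ^^ 3 \<longleftrightarrow> (\<exists>a b. (u, a) \<in> R \<and> (a, b) \<in> R \<and> (b, v) \<in> R)"
  by (auto simp: numeral_3_eq_3)

lemma relpow_4: "(u, v) \<in> R ^^ 4 \<longleftrightarrow>
    (\<exists>a b c. (u, a) \<in> R \<and> (a, b) \<in> R \<and> (b, c) \<in> R \<and> (c, v) \<in> R)"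
  by (simp add: eval_nat_numeral relcomp_unfold) blast

locale nontrivial_connected_graph = connected_pair_graph +
  assumes order_ge_2: "2 \<le> card (pverts G)"
begin

lemma ex_neighbour:
  assumes "u \<in> pverts G"
  obtains v where "(u, v) \<in> parcs G"
proof -
  have "\<not> pverts G \<subseteq> {u}" using order_ge_2 card_mono[of "{u}" "pverts G"] by auto
  then obtain v where "v \<in> pverts G" "v \<noteq> u" by auto
  then show ?thesis using connected_rtrancl[OF assms, of v] that by (auto elim: converse_rtranclE)
qed

sublocale myc: connected_pair_graph "mycielskian G"
proof -
  interpret M: pair_graph "mycielskian G" by (rule pair_graph_mycielskian) (rule pair_graph_axioms)
  have root: "(x, Root) \<in> (parcs (mycielskian G))\<^sup>* \<and> (Root, x) \<in> (parcs (mycielskian G))\<^sup>*"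
    if x: "x \<in> pverts (mycielskian G)" for x
  proof (cases x)
    case (Orig u)
    then have "u \<in> pverts G" using x by simp
    then obtain v where v: "(u, v) \<in> parcs G" by (rule ex_neighbour)
    then have "v \<in> pverts G" "(v, u) \<in> parcs G" by (auto dest: in_arcsD2 arc_sym)
    with v have "(Orig u, Copy v) \<in> parcs (mycielskian G)" "(Copy v, Root) \<in> parcs (mycielskian G)"
      "(Root, Copy v) \<in> parcs (mycielskian G)" "(Copy v, Orig u) \<in> parcs (mycielskian G)" by simp_all
    then show ?thesis unfolding Orig by (meson r_into_rtrancl rtrancl_trans)
  qed (use x in auto)
  show "connected_pair_graph (mycielskian G)"
    by unfold_locales (meson root rtrancl_trans)
qed

lemma relpow_Orig: "(u, v) \<in> parcs G ^^ k \<Longrightarrow> (Orig u, Orig v) \<in> parcs (mycielskian G) ^^ k"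
proof (induction k arbitrary: v)
  case (Suc k)
  then obtain w where "(u, w) \<in> parcs G ^^ k" "(w, v) \<in> parcs G" by auto
  then show ?case using Suc.IH by (intro relpow_Suc_I[of _ "Orig w"]) auto
qed simp

text \<open>
  A walk that avoids the root projects to the graph with the same length. Every original
  is at distance \<open>2\<close> from the root, so a walk through the root has length at least \<open>4\<close>, and as no
  vertex is isolated, length \<open>4\<close> is possible.
\<close>

lemma gdist_Orig_Orig:
  assumes "u \<in> pverts G" "v \<in> pverts G"
  shows "gdist (mycielskian G) (Orig u) (Orig v) = min (gdist G u v) 4"
proof (rule gdist_eqI)
  obtain a b where "(u, a) \<in> parcs G" "(v, b) \<in> parcs G" using assms ex_neighbour by metis
  then have "(Orig u, Orig v) \<in> parcs (mycielskian G) ^^ 4"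
    unfolding relpow_4
    by (intro exI[of _ "Copy a"] exI[of _ Root] exI[of _ "Copy b"])
      (auto dest: in_arcsD2 arc_sym)
  then show "(Orig u, Orig v) \<in> parcs (mycielskian G) ^^ min (gdist G u v) 4"
    using relpow_Orig gdist_walk[OF assms] by (auto simp: min_def)
next
  fix j assume j: "j < min (gdist G u v) 4"
  have "(Orig u, Orig v) \<in> parcs (mycielskian G) ^^ j \<Longrightarrow> (u, v) \<in> parcs G ^^ j"
  proof -
    consider "j = 0" | "j = 1" | "j = 2" | "j = 3" using j by linarith
    then show "(Orig u, Orig v) \<in> parcs (mycielskian G) ^^ j \<Longrightarrow> (u, v) \<in> parcs G ^^ j"
      by cases (auto simp: relpow_2 relpow_3 ex_myc_vertex)
  qed
  then show "(Orig u, Orig v) \<notin> parcs (mycielskian G) ^^ j"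
    using j gdist_le[of u v j G] by auto
qed

text \<open>
  As between originals, except that the copy is adjacent to the root. A vertex is at distance \<open>0\<close>
  from itself but has to pass through a neighbour to reach its own copy.
\<close>

lemma gdist_Orig_Copy:
  assumes "u \<in> pverts G" "v \<in> pverts G"
  shows "gdist (mycielskian G) (Orig u) (Copy v) = (if u = v then 2 else min (gdist G u v) 3)"
proof (rule gdist_eqI)
  have lift': "(Orig u, Copy v) \<in> parcs (mycielskian G) ^^ Suc k" if walk: "(u, v) \<in> parcs G ^^ Suc k" for k
  proof -
    obtain w where "(u, w) \<in> parcs G ^^ k" "(w, v) \<in> parcs G" using walk by auto
    then show ?thesis using relpow_Orig by (auto intro!: relcompI[of _ "Orig w"])
  qed
  obtain a where a: "(u, a) \<in> parcs G" using assms ex_neighbour by metis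
  have three: "(Orig u, Copy v) \<in> parcs (mycielskian G) ^^ 3"
    unfolding relpow_3 using a assms
    by (intro exI[of _ "Copy a"] exI[of _ Root]) (auto dest: in_arcsD2)
  show "(Orig u, Copy v) \<in> parcs (mycielskian G) ^^ (if u = v then 2 else min (gdist G u v) 3)"
  proof (cases "u = v")
    case True
    have "(Orig u, Copy u) \<in> parcs (mycielskian G) ^^ 2"
      unfolding relpow_2 using a arc_sym by (intro exI[of _ "Orig a"]) auto
    with True show ?thesis by simp
  next
    case False
    then obtain k where k: "gdist G u v = Suc k" using gdist_eq_0_iff[OF assms] not0_implies_Suc by blast
    then have "(Orig u, Copy v) \<in> parcs (mycielskian G) ^^ gdist G u v"
      using lift' gdist_walk[OF assms] by metis
    with three False show ?thesis by (auto simp: min_def)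
  qed
next
  fix j assume j: "j < (if u = v then 2 else min (gdist G u v) 3)"
  then have "j < 3" "j = 2 \<longrightarrow> u \<noteq> v" by (auto split: if_splits)
  then consider "j = 0" | "j = 1" | "j = 2" "u \<noteq> v" by linarith
  then show "(Orig u, Copy v) \<notin> parcs (mycielskian G) ^^ j"
  proof cases
    case 2
    then show ?thesis using j gdist_le[of u v 1 G] no_loops'[of u v] by (auto split: if_splits)
  next
    case 3
    then have "(u, v) \<notin> parcs G ^^ 2" using j gdist_le[of u v 2 G] by auto
    with 3 show ?thesis by (auto simp: relpow_2 ex_myc_vertex)
  qed simp
qed

lemma gdist_Copy_Orig:
  assumes "u \<in> pverts G" "v \<in> pverts G"
  shows "gdist (mycielskian G) (Copy u) (Orig v) = (if u = v then 2 else min (gdist G u v) 3)"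
  using gdist_Orig_Copy[OF assms(2,1)] by (auto simp: myc.gdist_sym[of "Copy u"] gdist_sym[of u v])

lemma gdist_Copy_Copy:
  assumes "u \<in> pverts G" "v \<in> pverts G" "u \<noteq> v"
  shows "gdist (mycielskian G) (Copy u) (Copy v) = 2"
proof (rule gdist_eqI)
  show "(Copy u, Copy v) \<in> parcs (mycielskian G) ^^ 2"
    unfolding relpow_2 using assms by (intro exI[of _ Root]) auto
next
  fix j :: nat assume "j < 2"
  then consider "j = 0" | "j = 1" by linarith
  then show "(Copy u, Copy v) \<notin> parcs (mycielskian G) ^^ j" by cases (auto simp: assms)
qed

lemma gdist_Copy_Root:
  assumes "u \<in> pverts G"
  shows "gdist (mycielskian G) (Copy u) Root = 1" "gdist (mycielskian G) Root (Copy u) = 1"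
proof -
  show "gdist (mycielskian G) (Copy u) Root = 1" by (rule gdist_eqI) (auto simp: assms)
  then show "gdist (mycielskian G) Root (Copy u) = 1" by (simp add: myc.gdist_sym)
qed

lemma gdist_Orig_Root:
  assumes "u \<in> pverts G"
  shows "gdist (mycielskian G) (Orig u) Root = 2" "gdist (mycielskian G) Root (Orig u) = 2"
proof -
  obtain a where a: "(u, a) \<in> parcs G" using assms ex_neighbour by metis
  show "gdist (mycielskian G) (Orig u) Root = 2"
  proof (rule gdist_eqI)
    show "(Orig u, Root) \<in> parcs (mycielskian G) ^^ 2"
      unfolding relpow_2 using a by (intro exI[of _ "Copy a"]) (auto dest: in_arcsD2)
  next
    fix j :: nat assume "j < 2"
    then consider "j = 0" | "j = 1" by linarith
    then show "(Orig u, Root) \<notin> parcs (mycielskian G) ^^ j" by cases auto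
  qed
  then show "gdist (mycielskian G) Root (Orig u) = 2" by (simp add: myc.gdist_sym)
qed

lemmas gdist_mycielskian = gdist_Orig_Orig gdist_Orig_Copy gdist_Copy_Orig gdist_Copy_Copy
  gdist_Copy_Root gdist_Orig_Root

end

section \<open>Graphs in which every vertex is a leaf or a support vertex\<close>

locale leaf_support_graph = connected_pair_graph +
  assumes order_ge_3: "3 \<le> card (pverts G)"
    and leaf_or_support: "v \<in> pverts G \<Longrightarrow> leaf G v \<or> support_vertex G v"

sublocale leaf_support_graph \<subseteq> nontrivial_connected_graph
  using order_ge_3 by unfold_locales simp

context leaf_support_graph
begin

abbreviation leaves :: "'a set" where
  "leaves \<equiv> {v. leaf G v}"

lemma leaf_iff: "leaf G v \<longleftrightarrow> v \<in> pverts G \<and> (\<exists>s. \<forall>u. (v, u) \<in> parcs G \<longleftrightarrow> u = s)"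
proof -
  have "out_arcs (with_proj G) v = Pair v ` {u. (v, u) \<in> parcs G}" by (auto simp: out_arcs_def)
  then have "out_degree (with_proj G) v = card {u. (v, u) \<in> parcs G}"
    unfolding out_degree_def by (simp add: card_image inj_on_def)
  then show ?thesis unfolding leaf_def by (auto simp: card_1_singleton_iff set_eq_iff)
qed

lemma leaf_nbr_unique:
  assumes "leaf G l" "(l, s) \<in> parcs G" "(l, t) \<in> parcs G"
  shows "t = s"
  using assms leaf_iff by metis

lemma leaf_in_verts: "leaf G l \<Longrightarrow> l \<in> pverts G"
  by (simp add: leaf_def)

lemma leaves_subset: "leaves \<subseteq> pverts G"
  using leaf_in_verts by auto

lemma finite_leaves: "finite leaves"
  using finite_subset[OF leaves_subset pair_finite_verts] .

text \<open>
  Two adjacent leaves form a connected component, and the graph has a third vertex.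
\<close>

lemma leaf_nbr_not_leaf:
  assumes "leaf G l" "(l, s) \<in> parcs G"
  shows "\<not> leaf G s"
proof
  assume "leaf G s"
  have "v \<in> {l, s}" if "(l, v) \<in> (parcs G)\<^sup>*" for v
    using that
  proof (induction rule: rtrancl_induct)
    case (step y z)
    then show ?case
      using leaf_nbr_unique[OF assms] leaf_nbr_unique[OF \<open>leaf G s\<close> arc_sym[OF assms(2)]] by blast
  qed simp
  then have "pverts G \<subseteq> {l, s}" using connected_rtrancl leaf_in_verts[OF assms(1)] by blast
  then have "card (pverts G) \<le> card {l, s}" by (intro card_mono) auto
  also have "\<dots> \<le> 2" by (simp add: card_insert_if)
  finally show False using order_ge_3 by simp
qed

text \<open>
  Every walk that leaves \<open>l\<close> starts with the step to \<open>s\<close>.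
\<close>

lemma leaf_gdist:
  assumes "leaf G l" "(l, s) \<in> parcs G" "x \<in> pverts G" "x \<noteq> l"
  shows "gdist G l x = Suc (gdist G s x)"
proof (rule gdist_eqI)
  have V: "l \<in> pverts G" "s \<in> pverts G" using assms by (auto dest: in_arcsD1 in_arcsD2)
  show "(l, x) \<in> parcs G ^^ Suc (gdist G s x)"
    using gdist_walk[of s x] V assms by (intro relpow_Suc_I2[of l s]) auto
  fix j assume j: "j < Suc (gdist G s x)"
  show "(l, x) \<notin> parcs G ^^ j"
  proof
    assume w: "(l, x) \<in> parcs G ^^ j"
    with assms(4) obtain i where i: "j = Suc i" by (cases j) auto
    then obtain t where "(l, t) \<in> parcs G" "(t, x) \<in> parcs G ^^ i"
      using w by (metis relpow_Suc_D2)
    then have "(s, x) \<in> parcs G ^^ i" using leaf_nbr_unique[OF assms(1,2)] by blast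
    then show False using gdist_le j i by fastforce
  qed
qed

lemma nonleaf_other_nbr:
  assumes "\<not> leaf G s" "(s, l) \<in> parcs G"
  obtains t where "(s, t) \<in> parcs G" "t \<noteq> l"
  using assms leaf_iff[of s] in_arcsD1 by metis

lemma nonleaf_has_leaf:
  assumes "s \<in> pverts G" "\<not> leaf G s"
  shows "\<exists>l. leaf G l \<and> (s, l) \<in> parcs G"
  using leaf_or_support[OF assms(1)] assms(2) by (auto simp: support_vertex_def)

lemma leaf_has_nbr:
  assumes "leaf G l"
  obtains s where "(l, s) \<in> parcs G"
  using assms leaf_iff by blast

text \<open>
  The neighbour \<open>s\<close> of a leaf is not a leaf, so it has another neighbour \<open>t\<close>. Either \<open>t\<close> is the second
  leaf, or a leaf at \<open>t\<close> is.
\<close>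

lemma num_leaves_ge_2: "2 \<le> num_leaves G"
proof -
  obtain v where "v \<in> pverts G" using order_ge_3 by fastforce
  then obtain l where l: "leaf G l" using leaf_or_support by (auto simp: support_vertex_def)
  then obtain s where s: "(l, s) \<in> parcs G" by (rule leaf_has_nbr)
  then have nl: "\<not> leaf G s" using l leaf_nbr_not_leaf by blast
  obtain t where t: "(s, t) \<in> parcs G" "t \<noteq> l" using nonleaf_other_nbr[OF nl arc_sym[OF s]] .
  have "\<exists>m. leaf G m \<and> m \<noteq> l"
  proof (cases "leaf G t")
    case False
    have "t \<in> pverts G" using t by (auto dest: in_arcsD2)
    then obtain m where m: "leaf G m" "(t, m) \<in> parcs G" using nonleaf_has_leaf False by blast
    have "m \<noteq> l"
    proof
      assume "m = l"
      then have "t = s" using leaf_nbr_unique[OF l s, of t] m arc_sym by blast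
      then show False using t no_loops' by blast
    qed
    then show ?thesis using m by blast
  qed (use t in blast)
  then obtain m where "{l, m} \<subseteq> leaves" "m \<noteq> l" using l by auto
  then show ?thesis using card_mono[OF finite_leaves, of "{l, m}"] by (simp add: num_leaves_def)
qed

text \<open>
  Choose a leaf \<open>f s\<close> for each non-leaf \<open>s\<close>. The function \<open>f\<close> is injective because a leaf has only one
  neighbour, so the vertices split into pairs \<open>s\<close>, \<open>f s\<close> and single leaves, as many blocks as there
  are leaves.
\<close>

lemma weight_le_leaves:
  fixes c :: "'a \<Rightarrow> nat"
  assumes leaf_bound: "\<And>l. leaf G l \<Longrightarrow> c l \<le> k"
    and pair_bound: "\<And>s l. leaf G l \<Longrightarrow> (s, l) \<in> parcs G \<Longrightarrow> c s + c l \<le> k"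
  shows "(\<Sum>v\<in>pverts G. c v) \<le> k * num_leaves G"
proof -
  define P where "P = pverts G - leaves"
  have "\<forall>s\<in>P. \<exists>l. leaf G l \<and> (s, l) \<in> parcs G"
    by (simp add: P_def nonleaf_has_leaf)
  then obtain f where f: "\<And>s. s \<in> P \<Longrightarrow> leaf G (f s) \<and> (s, f s) \<in> parcs G" by metis
  have inj: "inj_on f P"
    by (rule inj_onI) (metis f arc_sym leaf_nbr_unique)
  have sub: "f ` P \<subseteq> leaves" using f by auto
  have "(\<Sum>v\<in>P. c v) + (\<Sum>v\<in>f ` P. c v) = (\<Sum>s\<in>P. c s + c (f s))"
    by (simp add: sum.distrib sum.reindex[OF inj])
  also have "\<dots> \<le> k * card P"
    using sum_bounded_above[of P "\<lambda>s. c s + c (f s)" k] f pair_bound by (simp add: mult.commute)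
  finally have 1: "(\<Sum>v\<in>P. c v) + (\<Sum>v\<in>f ` P. c v) \<le> k * card P" .
  have 2: "(\<Sum>v\<in>leaves - f ` P. c v) \<le> k * (card leaves - card P)"
    using sum_bounded_above[of "leaves - f ` P" c k] leaf_bound
      card_Diff_subset[OF finite_subset[OF sub finite_leaves] sub] card_image[OF inj]
    by (simp add: mult.commute)
  have "(\<Sum>v\<in>pverts G. c v) = (\<Sum>v\<in>P. c v) + (\<Sum>v\<in>leaves. c v)"
    unfolding P_def by (rule sum.subset_diff[OF leaves_subset pair_finite_verts])
  also have "(\<Sum>v\<in>leaves. c v) = (\<Sum>v\<in>leaves - f ` P. c v) + (\<Sum>v\<in>f ` P. c v)"
    by (rule sum.subset_diff[OF sub finite_leaves])
  also have "(\<Sum>v\<in>P. c v) + \<dots> \<le> k * card P + k * (card leaves - card P)"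
    using 1 2 by linarith
  also have "\<dots> = k * card leaves"
    using card_mono[OF finite_leaves sub] card_image[OF inj]
    by (simp flip: distrib_left)
  finally show ?thesis by (simp add: num_leaves_def)
qed

lemma order_le_twice_leaves: "card (pverts G) \<le> 2 * num_leaves G"
  using weight_le_leaves[of "\<lambda>_. 1" 2] by simp

lemma card_le_num_leaves:
  assumes "A \<subseteq> pverts G"
    and "\<And>s l. leaf G l \<Longrightarrow> (s, l) \<in> parcs G \<Longrightarrow> s \<notin> A \<or> l \<notin> A"
  shows "card A \<le> num_leaves G"
proof -
  have "(\<Sum>v\<in>pverts G. of_bool (v \<in> A)) \<le> 1 * num_leaves G"
    by (rule weight_le_leaves) (use assms(2) in \<open>auto simp: of_bool_def\<close>)
  moreover have "pverts G \<inter> {v. v \<in> A} = A" using assms(1) by auto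
  ultimately show ?thesis by (simp add: pair_finite_verts)
qed

section \<open>The independent 4-position number\<close>

text \<open>
  A walk through a leaf visits its neighbour before and after it, and can be shortened by \<open>2\<close>.
\<close>

lemma leaf_not_between:
  assumes "leaf G y" "x \<in> pverts G" "z \<in> pverts G" "x \<noteq> y" "z \<noteq> y"
  shows "gdist G x z < gdist G x y + gdist G y z"
proof -
  obtain s where s: "(y, s) \<in> parcs G" using assms leaf_has_nbr by blast
  have "gdist G x z \<le> gdist G s x + gdist G s z"
    using gdist_triangle[of x s z] assms s gdist_sym[of x s] by (auto dest: in_arcsD2)
  then show ?thesis using leaf_gdist[OF assms(1) s] assms gdist_sym[of x y] by simp
qed

lemma independent_position_leaves: "independent_position_set k G leaves"
proof (rule independent_position_setI)
  show "independent_set G leaves"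
    using leaf_nbr_not_leaf leaves_subset by (auto simp: independent_set_def)
  fix x y z assume "x \<in> leaves" "y \<in> leaves" "z \<in> leaves" "x \<noteq> y" "y \<noteq> z"
  then show "gdist G x z \<noteq> gdist G x y + gdist G y z"
    using leaf_not_between[of y x z] leaf_in_verts by fastforce
qed

lemma ip_eq_num_leaves: "ip k G = num_leaves G"
  unfolding ip_def
proof (rule Max_card_eqI[OF pair_finite_verts])
  fix S assume "independent_position_set k G S"
  then have S: "S \<subseteq> pverts G" "\<And>u v. u \<in> S \<Longrightarrow> v \<in> S \<Longrightarrow> (u, v) \<notin> parcs G"
    by (auto simp: independent_position_set_def independent_set_def)
  then show "S \<subseteq> pverts G" by simp
  show "card S \<le> num_leaves G" using S by (intro card_le_num_leaves) auto
qed (auto simp: num_leaves_def intro: independent_position_leaves)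

section \<open>The general position number of the Mycielskian\<close>

lemma general_position_doubled_leaves:
  "general_position_set (mycielskian G) (Orig ` leaves \<union> Copy ` leaves)"
proof -
  let ?D = "gdist (mycielskian G)" and ?S = "Orig ` leaves \<union> Copy ` leaves"
  have ge2: "2 \<le> gdist G u v" if "leaf G u" "leaf G v" "u \<noteq> v" for u v
    using gdist_eq_0_iff[of u v] gdist_eq_1_iff[of u v] that leaf_nbr_not_leaf leaf_in_verts
    by (metis One_nat_def less_2_cases not_less)
  have lower: "2 \<le> ?D x y" if xy: "x \<in> ?S" "y \<in> ?S" "x \<noteq> y" for x y
  proof -
    obtain u v where "x = Orig u \<or> x = Copy u" "y = Orig v \<or> y = Copy v" "leaf G u" "leaf G v"
      using xy by blast
    then show ?thesis
      using \<open>x \<noteq> y\<close> ge2[of u v] leaf_in_verts by (cases "u = v") (auto simp: gdist_mycielskian)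
  qed
  (* Only two originals at distance 4 leave room for a third vertex, which sits over a leaf
     at distance 2 from both; that leaf has a single neighbour. *)
  have far: "\<exists>u v. x = Orig u \<and> z = Orig v \<and> 4 \<le> gdist G u v"
    if "x \<in> ?S" "z \<in> ?S" "x \<noteq> z" "4 \<le> ?D x z" for x z
    using that leaf_in_verts by (auto simp: gdist_mycielskian split: if_splits)
  have "?D x z \<noteq> ?D x y + ?D y z"
    if xyz: "x \<in> ?S" "y \<in> ?S" "z \<in> ?S" "x \<noteq> y" "y \<noteq> z" "x \<noteq> z" for x y z
  proof
    assume col: "?D x z = ?D x y + ?D y z"
    have two: "2 \<le> ?D x y" "2 \<le> ?D y z" using lower xyz by auto
    then obtain u v where uv: "x = Orig u" "z = Orig v" "4 \<le> gdist G u v" "leaf G u" "leaf G v"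
      using far[of x z] xyz col by auto
    have le4: "?D x z \<le> 4" using uv leaf_in_verts by (simp add: gdist_mycielskian)
    obtain w where w: "leaf G w" "y = Orig w \<or> y = Copy w" using xyz by auto
    have V: "u \<in> pverts G" "v \<in> pverts G" "w \<in> pverts G" using uv w leaf_in_verts by auto
    have d: "?D x y = 2" "?D y z = 2" using two le4 col by linarith+
    have near: "gdist G u w \<le> 2" "gdist G w v \<le> 2"
      using d w(2) V uv(1,2) by (auto simp: gdist_mycielskian min_def split: if_splits)
    then have "gdist G u v \<le> 4" using gdist_triangle[of u w v] V by simp
    then show False
      using leaf_not_between[OF w(1), of u v] near uv V gdist_eq_0_iff[of u w] gdist_eq_0_iff[of w v]
      by (cases "u = w"; cases "w = v") auto
  qed
  then show ?thesis
    unfolding myc.general_position_set_iff using leaf_in_verts by auto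
qed

lemma card_doubled_leaves: "card (Orig ` leaves \<union> Copy ` leaves) = 2 * num_leaves G"
  using finite_leaves
  by (subst card_Un_disjoint) (auto simp: card_image inj_on_def num_leaves_def)

text \<open>
  The sets \<open>A\<close> and \<open>B\<close> below are the vertices whose original, respectively copy, is in \<open>S\<close>. Weights
  settle the case without a pair \<open>s\<close>, \<open>l\<close> of weight more than \<open>2\<close>. Otherwise there are two cases.

  If the original of \<open>s\<close> and the copy of \<open>l\<close> are in \<open>S\<close>, every other vertex with an original in \<open>S\<close> is
  at distance \<open>3\<close> from \<open>s\<close>, and every other vertex with a copy in \<open>S\<close> at distance \<open>2\<close>. Hence it
  contributes at most one element, and a second neighbour of \<open>s\<close> contributes none.

  If the original of \<open>l\<close> and the copy of \<open>s\<close> are in \<open>S\<close>, they exclude all further originals, and the copies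
  of vertices at distance at least \<open>3\<close> from \<open>l\<close>. So \<open>S\<close> has at most as many elements as there are
  vertices unless it contains all copies; in that case all leaves are attached to \<open>s\<close>, the graph is a star,
  and the order is only one more than the number of leaves.
\<close>

lemma general_position_card_le:
  assumes "general_position_set (mycielskian G) S"
  shows "card S \<le> 2 * num_leaves G"
proof -
  let ?D = "gdist (mycielskian G)" and ?V = "pverts G"
  have SV: "S \<subseteq> pverts (mycielskian G)"
    and gen: "\<And>x y z. x \<in> S \<Longrightarrow> y \<in> S \<Longrightarrow> z \<in> S \<Longrightarrow> x \<noteq> y \<Longrightarrow> y \<noteq> z \<Longrightarrow> x \<noteq> z \<Longrightarrow>
      ?D x z \<noteq> ?D x y + ?D y z"
    using assms unfolding myc.general_position_set_iff by blast+
  define A where "A = {v. Orig v \<in> S}"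
  define B where "B = {v. Copy v \<in> S}"
  have A: "v \<in> A \<longleftrightarrow> Orig v \<in> S" and B: "v \<in> B \<longleftrightarrow> Copy v \<in> S" for v
    by (auto simp: A_def B_def)
  have AV: "A \<subseteq> ?V" and BV: "B \<subseteq> ?V" using SV by (auto simp: A_def B_def)
  then have fin: "finite A" "finite B" using pair_finite_verts by (auto intro: finite_subset)
  have S_eq: "S = Orig ` A \<union> Copy ` B \<union> (S \<inter> {Root})" (is "_ = ?S")
  proof
    show "S \<subseteq> ?S"
    proof
      fix x assume "x \<in> S"
      then show "x \<in> ?S" using A B by (cases x) auto
    qed
  qed (auto simp: A_def B_def)
  have "card S = card (Orig ` A \<union> Copy ` B) + card (S \<inter> {Root})"
    by (subst S_eq, rule card_Un_disjoint) (use fin in auto)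
  also have "card (Orig ` A \<union> Copy ` B) = card A + card B"
    using fin by (subst card_Un_disjoint) (auto simp: card_image inj_on_def)
  finally have card_S: "card S = card A + card B + card (S \<inter> {Root})" .
  show ?thesis
  proof (cases "Root \<in> S")
    case True
    have "card B \<le> 1"
    proof (rule ccontr)
      assume "\<not> card B \<le> 1"
      then obtain u v where "u \<in> B" "v \<in> B" "u \<noteq> v"
        by (metis card_le_Suc0_iff_eq fin(2) One_nat_def)
      moreover have "u \<in> ?V" "v \<in> ?V" using \<open>u \<in> B\<close> \<open>v \<in> B\<close> BV by auto
      ultimately show False
        using gen[of "Copy u" Root "Copy v"] True by (auto simp: B gdist_mycielskian)
    qed
    (* Through the root there is always a connection of length 4 between originals. *)
    have close: "gdist G u v \<le> 3" if "u \<in> A" "v \<in> A" "u \<noteq> v" for u v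
      using gen[of "Orig u" Root "Orig v"] True AV that
      by (auto simp: A gdist_mycielskian subset_iff min_def split: if_splits)
    have "card A \<le> num_leaves G"
    proof (cases "\<exists>s l. leaf G l \<and> (s, l) \<in> parcs G \<and> s \<in> A \<and> l \<in> A")
      case True
      then obtain s l where sl: "leaf G l" "(s, l) \<in> parcs G" "s \<in> A" "l \<in> A" by blast
      have "A \<subseteq> {s, l}"
      proof
        fix x assume x: "x \<in> A"
        show "x \<in> {s, l}"
        proof (rule ccontr)
          assume nx: "x \<notin> {s, l}"
          have d: "gdist G l x = Suc (gdist G s x)"
            using leaf_gdist[OF sl(1) arc_sym[OF sl(2)]] x AV nx by auto
          have V: "s \<in> ?V" "l \<in> ?V" "x \<in> ?V" using sl x AV by auto
          have ls: "gdist G l s = 1" using gdist_eq_1_iff V arc_sym[OF sl(2)] by simp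
          have "l \<noteq> s" using no_loops' sl by blast
          then show False
            using gen[of "Orig l" "Orig s" "Orig x"] V d ls close[of l x] nx x sl
            by (auto simp: A gdist_mycielskian)
        qed
      qed
      then have "card A \<le> card {s, l}" by (intro card_mono) auto
      also have "\<dots> \<le> 2" by (simp add: card_insert_if)
      finally show ?thesis using num_leaves_ge_2 by simp
    next
      case False
      then show ?thesis by (intro card_le_num_leaves AV) blast
    qed
    moreover have "card (S \<inter> {Root}) \<le> 1" using card_mono[of "{Root}" "S \<inter> {Root}"] by simp
    ultimately show ?thesis using card_S \<open>card B \<le> 1\<close> num_leaves_ge_2 by linarith
  next
    case no_root: False
    then have card_S: "card S = card A + card B" using card_S by simp
    define c where "c v = (of_bool (v \<in> A) + of_bool (v \<in> B) :: nat)" for v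
    have sum_c: "(\<Sum>v\<in>?V. c v) = card A + card B"
    proof -
      have "?V \<inter> {v. v \<in> A} = A" "?V \<inter> {v. v \<in> B} = B" using AV BV by auto
      then show ?thesis unfolding c_def by (simp add: sum.distrib pair_finite_verts)
    qed
    show ?thesis
    proof (cases "\<exists>s l. leaf G l \<and> (s, l) \<in> parcs G \<and> 2 < c s + c l")
      case False
      have "(\<Sum>v\<in>?V. c v) \<le> 2 * num_leaves G"
        by (rule weight_le_leaves) (use False in \<open>auto simp: c_def not_less of_bool_def\<close>)
      then show ?thesis using sum_c card_S by simp
    next
      case True
      then obtain s l where sl: "leaf G l" "(s, l) \<in> parcs G" "2 < c s + c l" by blast
      have ls: "(l, s) \<in> parcs G" using sl arc_sym by blast
      have V: "s \<in> ?V" "l \<in> ?V" using sl by (auto dest: in_arcsD1 in_arcsD2)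
      have ne: "l \<noteq> s" using no_loops' sl by blast
      have s_nl: "\<not> leaf G s" using leaf_nbr_not_leaf[OF sl(1) ls] .
      have d1: "gdist G l s = 1" "gdist G s l = 1" using gdist_eq_1_iff V ls sl by auto
      have dl: "gdist G l x = Suc (gdist G s x)" if "x \<in> ?V" "x \<noteq> l" for x
        using leaf_gdist[OF sl(1) ls] that by simp
      have bad1: "\<not> (s \<in> B \<and> l \<in> A \<and> s \<in> A)"
        using gen[of "Copy s" "Orig l" "Orig s"] V ne d1 by (auto simp: A B gdist_mycielskian)
      have bad2: "\<not> (l \<in> A \<and> s \<in> A \<and> l \<in> B)"
        using gen[of "Orig l" "Orig s" "Copy l"] V ne d1 by (auto simp: A B gdist_mycielskian)
      have "s \<in> A \<and> s \<in> B \<and> l \<in> B \<and> l \<notin> A \<or> l \<in> A \<and> s \<in> B \<and> l \<in> B \<and> s \<notin> A"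
        using sl(3) bad1 bad2 by (auto simp: c_def of_bool_def split: if_splits)
      then show ?thesis
      proof
        assume T: "s \<in> A \<and> s \<in> B \<and> l \<in> B \<and> l \<notin> A"
        (* At smaller distance s lies between x and the copy of l; at larger distance that copy
           lies on a connection from s to x through the root. *)
        have dA: "gdist G s x = 3" if x: "x \<in> A" "x \<noteq> s" for x
        proof -
          have xV: "x \<in> ?V" "x \<noteq> l" using x AV T by auto
          have "gdist G s x \<noteq> 0" using gdist_eq_0_iff V xV x by auto
          moreover have "\<not> gdist G s x \<le> 2"
            using gen[of "Copy l" "Orig s" "Orig x"] V xV x T dl[OF xV] d1 ne
            by (auto simp: A B gdist_mycielskian)
          moreover have "\<not> 4 \<le> gdist G s x"
            using gen[of "Orig s" "Copy l" "Orig x"] V xV x T dl[OF xV] d1 ne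
            by (auto simp: A B gdist_mycielskian)
          ultimately show ?thesis by linarith
        qed
        have dB: "gdist G s x = 2" if x: "x \<in> B" "x \<noteq> s" "x \<noteq> l" for x
        proof -
          have xV: "x \<in> ?V" using x BV by auto
          have "gdist G s x \<noteq> 0" using gdist_eq_0_iff V xV x by auto
          moreover have "gdist G s x \<noteq> 1"
            using gen[of "Copy l" "Orig s" "Copy x"] V xV x T d1 ne
            by (auto simp: A B gdist_mycielskian)
          moreover have "\<not> 3 \<le> gdist G s x"
            using gen[of "Orig s" "Copy l" "Copy x"] V xV x T d1 ne
            by (auto simp: A B gdist_mycielskian)
          ultimately show ?thesis by linarith
        qed
        obtain t where t: "(s, t) \<in> parcs G" "t \<noteq> l" using nonleaf_other_nbr[OF s_nl sl(2)] .
        then have tV: "t \<in> ?V" "t \<noteq> s" using no_loops' by (auto dest: in_arcsD2)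
        have dt: "gdist G s t = 1" using gdist_eq_1_iff V tV t by simp
        have "(A - {s}) \<union> (B - {s, l}) \<subseteq> ?V - {s, l, t}"
          using AV BV T dA[of t] dB[of t] dt tV by auto
        then have "card ((A - {s}) \<union> (B - {s, l})) \<le> card (?V - {s, l, t})"
          using pair_finite_verts by (intro card_mono) auto
        (* The two sets are disjoint by the distances 3 and 2 just shown. *)
        also have "\<dots> = card ?V - 3"
          using V tV t ne by (subst card_Diff_subset) auto
        also have "card ((A - {s}) \<union> (B - {s, l})) = card (A - {s}) + card (B - {s, l})"
          using fin dA dB by (intro card_Un_disjoint) fastforce+
        also have "card (A - {s}) = card A - 1" using T fin by simp
        also have "card (B - {s, l}) = card B - 2" using T fin ne by (subst card_Diff_subset) auto
        finally have "card A - 1 + (card B - 2) \<le> card ?V - 3" .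
        then have "card A + card B \<le> card ?V" using order_ge_3 by linarith
        then show ?thesis using card_S order_le_twice_leaves by simp
      next
        assume T: "l \<in> A \<and> s \<in> B \<and> l \<in> B \<and> s \<notin> A"
        have "x = l" if x: "x \<in> A" for x
        proof (rule ccontr)
          assume "x \<noteq> l"
          then have xV: "x \<in> ?V" "x \<noteq> l" "x \<noteq> s" using x AV T by auto
          then show False
            using gen[of "Orig l" "Copy s" "Orig x"] V x T dl[of x] d1 ne
            by (auto simp: A B gdist_mycielskian)
        qed
        then have "A = {l}" using T by auto
        then have card_A: "card A = 1" by simp
        have dB: "gdist G l x < 3" if x: "x \<in> B" "x \<noteq> l" "x \<noteq> s" for x
          using gen[of "Orig l" "Copy s" "Copy x"] V BV x T d1 ne
          by (auto simp: A B gdist_mycielskian subset_iff)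
        show ?thesis
        proof (cases "B = ?V")
          case False
          then have "card B < card ?V" using BV pair_finite_verts psubset_card_mono by blast
          then show ?thesis using card_S card_A order_le_twice_leaves by linarith
        next
          case True
          have at_s: "(m, s) \<in> parcs G" if m: "leaf G m" for m
          proof (cases "m = l")
            case False
            have "m \<noteq> s" using m s_nl by auto
            have mV: "m \<in> ?V" using leaf_in_verts m by blast
            then have "gdist G s m < 2" using dB[of m] True False \<open>m \<noteq> s\<close> dl[of m] by simp
            then have "gdist G s m = Suc 0"
              using gdist_eq_0_iff[of s m] V mV \<open>m \<noteq> s\<close> by auto
            then show ?thesis using gdist_eq_1_iff[of s m] V mV arc_sym by blast
          qed (use ls in simp)
          have "?V \<subseteq> insert s leaves"
          proof
            fix v assume v: "v \<in> ?V"
            show "v \<in> insert s leaves"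
            proof (cases "leaf G v")
              case False
              then obtain m where m: "leaf G m" "(v, m) \<in> parcs G" using nonleaf_has_leaf v by blast
              then have "v = s" using leaf_nbr_unique[OF m(1) at_s[OF m(1)]] arc_sym by blast
              then show ?thesis by simp
            qed simp
          qed
          then have "card ?V \<le> card (insert s leaves)" using finite_leaves by (intro card_mono) auto
          also have "\<dots> \<le> Suc (num_leaves G)"
            unfolding num_leaves_def by (rule card_insert_le_m1) simp_all
          finally show ?thesis using card_S card_A True num_leaves_ge_2 by simp
        qed
      qed
    qed
  qed
qed

lemma gp_mycielskian: "gp (mycielskian G) = 2 * num_leaves G"
  unfolding gp_def
proof (rule Max_card_eqI[OF myc.pair_finite_verts])
  show "general_position_set (mycielskian G) (Orig ` leaves \<union> Copy ` leaves)"
    by (rule general_position_doubled_leaves)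
qed (auto simp: general_position_set_def card_doubled_leaves general_position_card_le)

lemma not_complete: "\<not> complete_digraph n (with_proj G)"
proof
  assume "complete_digraph n (with_proj G)"
  then have complete: "parcs G = {(u, v). (u, v) \<in> pverts G \<times> pverts G \<and> u \<noteq> v}"
    by (simp add: complete_digraph_pair_def)
  have "leaves \<noteq> {}"
    using num_leaves_ge_2 unfolding num_leaves_def by (metis card.empty not_numeral_le_zero)
  then obtain l where l: "leaf G l" by auto
  then obtain s where "(l, s) \<in> parcs G" by (rule leaf_has_nbr)
  with l have ls: "leaf G l" "(l, s) \<in> parcs G" by simp_all
  have "pverts G \<subseteq> {l, s}"
    using leaf_nbr_unique[OF ls] leaf_in_verts[OF ls(1)] complete by blast
  then have "card (pverts G) \<le> card {l, s}" by (intro card_mono) auto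
  also have "\<dots> \<le> 2" by (simp add: card_insert_if)
  finally show False using order_ge_3 by simp
qed

lemma meagre: "meagre G"
  unfolding meagre_def ip_eq_num_leaves gp_mycielskian
  using not_complete order_ge_3 order_le_twice_leaves pair_graph_axioms by simp

end

section \<open>Trees\<close>

theorem corollary34:
  fixes T :: "'a pair_pre_digraph"
  assumes "undirected_tree T"
    and "card (pverts T) \<ge> 3"
    and "\<forall>v \<in> pverts T. leaf T v \<or> support_vertex T v"
  shows "gp (mycielskian T) = 2 * num_leaves T \<and> meagre T"
proof -
  interpret pair_graph T using assms(1) by (simp add: undirected_tree_def)
  have "arcs_ends (mk_symmetric (with_proj T)) = parcs T"
    using pair_sym_arcs by (simp add: adj_mk_symmetric_eq)
  moreover have "strongly_connected (mk_symmetric (with_proj T))"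
    using assms(1) by (simp add: undirected_tree_def Digraph_Component.connected_def)
  ultimately have "(u, v) \<in> (parcs T)\<^sup>*" if "u \<in> pverts T" "v \<in> pverts T" for u v
    using that reachable_rtranclI[of "mk_symmetric (with_proj T)" u v]
    by (auto simp: strongly_connected_def)
  then interpret leaf_support_graph T
    using assms by unfold_locales auto
  show ?thesis using gp_mycielskian meagre by blast
qed

end
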